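(* Let $n\ge2$ and let $A=(a_{ij})\in\mathbb{M}(n)$ be a nonnegative matrix. Then $$\rho(A)\ \ge\ \frac{b_{11}+b_{22}}{2}+\max_{1\le k\le n}\sqrt{\sum_{\substack{j=1\\ j\ne k}}^{n}x_{jk}^2},$$ where $b_{11}$ and $b_{22}$ are respectively the first and the second smallest diagonal entries of $A$ and $x_{jk}=\min\{a_{jk},a_{kj}\}$.
   Context: $\mathbb{M}(n)$ is the algebra of all $n\times n$ complex matrices. A matrix $A=(a_{ij})$ is nonnegative if $a_{ij}\ge0$ for all $i,j$ (entrywise); $A$ is not assumed symmetric. $\rho(A)=\max\{|\lambda|:\lambda\in\sigma(A)\}$ is the spectral radius, where $\sigma(A)$ is the spectrum of $A$. The smallest diagonal entries are counted with multiplicity. *)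

theory Defs
  imports "Jordan_Normal_Form.Spectral_Radius" "HOL-Library.Nonpos_Ints"
begin

definition nonneg_matrix :: "complex mat \<Rightarrow> bool" where
  "nonneg_matrix A \<longleftrightarrow> (\<forall>i < dim_row A. \<forall>j < dim_col A. A $$ (i, j) \<in> \<real>\<^sub>\<ge>\<^sub>0)"

text \<open>Meant for matrices with real entries, on which \<^const>\<open>Re\<close> merely changes the type.
  Rows and columns are numbered from 0. The list is increasing and keeps repetitions,
  so its entries at positions 0 and 1 are the smallest and the second smallest diagonal
  entry, counted with multiplicity.\<close>

definition sorted_diag :: "complex mat \<Rightarrow> real list" where
  "sorted_diag A = sort (map Re (diag_mat A))"

definition min_sym_entry :: "complex mat \<Rightarrow> nat \<Rightarrow> nat \<Rightarrow> real" where
  "min_sym_entry A j k = min (Re (A $$ (j, k))) (Re (A $$ (k, j)))"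

end

theory Submission
  imports Defs "HOL-Combinatorics.List_Permutation"
begin

text \<open>
  For a nonnegative matrix \<open>A\<close>, a single inequality \<open>A x \<ge> l x\<close> with \<open>x \<ge> 0\<close> and \<open>x \<noteq> 0\<close>
  already gives \<open>\<rho>(A) \<ge> l\<close> (\<open>spectral_radius_ge_subinvariant\<close>): multiplying by \<open>A\<close> preserves
  inequalities, so \<open>A\<^sup>m x \<ge> l\<^sup>m x\<close> when \<open>l \<ge> 0\<close>. If \<open>\<rho>(A) < \<mu> < l\<close>, the powers of \<open>A / \<mu>\<close> would
  expand \<open>x\<close> at least like \<open>(l / \<mu>)\<^sup>m\<close>, although they stay bounded, since the spectral radius
  of \<open>A / \<mu>\<close> is below 1.

  It remains to find a test vector for each \<open>k\<close> (\<open>spectral_radius_ge_star\<close>). Off the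
  diagonal, only row and column \<open>k\<close> of \<open>A\<close> are used, with both \<open>a\<^sub>j\<^sub>k\<close> and
  \<open>a\<^sub>k\<^sub>j\<close> lowered to the symmetric value \<open>x\<^sub>j\<^sub>k\<close>: a weighted star with centre \<open>k\<close>.
  Write \<open>s\<^sup>2\<close> for the sum of the \<open>x\<^sub>j\<^sub>k\<^sup>2\<close> and \<open>p\<close> for the diagonal entry at the centre, and
  put \<open>q = b\<^sub>1\<^sub>1 + b\<^sub>2\<^sub>2 - p\<close>. Every other diagonal entry is at least \<open>q\<close>, because two diagonal
  entries in distinct places have sum at least \<open>b\<^sub>1\<^sub>1 + b\<^sub>2\<^sub>2\<close>. The largest eigenvalue of the
  star with diagonal entries \<open>p\<close> and \<open>q\<close> is a root of \<open>(z - p)(z - q) = s\<^sup>2\<close>, with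
  eigenvector \<open>z - q\<close> at the centre and \<open>x\<^sub>j\<^sub>k\<close> at the leaves. For
  \<open>l = (p + q) / 2 + s\<close> one only has \<open>(l - p)(l - q) \<le> s\<^sup>2\<close>, and this makes the vector with
  \<open>l\<close> in place of \<open>z\<close> satisfy the inequality that is needed, as long as \<open>l > q\<close>. If
  \<open>l \<le> q\<close>, a unit vector at any index other than \<open>k\<close> serves instead.
\<close>

section \<open>Nonnegative matrices and subinvariant vectors\<close>

lemma nonneg_matrixD:
  assumes "nonneg_matrix A" "A \<in> carrier_mat n m" "i < n" "j < m"
  shows "0 \<le> Re (A $$ (i, j))" "Im (A $$ (i, j)) = 0"
  using assms by (auto simp: nonneg_matrix_def complex_nonneg_Reals_iff)

lemma nonneg_mult_entry:
  assumes "nonneg_matrix A" "A \<in> carrier_mat n m" "nonneg_matrix B" "B \<in> carrier_mat m l"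
    and "i < n" "j < l"
  shows "Re ((A * B) $$ (i, j)) = (\<Sum>k\<in>{0..<m}. Re (A $$ (i, k)) * Re (B $$ (k, j)))"
    and "Im ((A * B) $$ (i, j)) = 0"
  using assms nonneg_matrixD[OF assms(1,2)] nonneg_matrixD[OF assms(3,4)]
  by (auto simp: scalar_prod_def)

lemma nonneg_matrix_pow:
  assumes "nonneg_matrix A" "A \<in> carrier_mat n n"
  shows "nonneg_matrix (A ^\<^sub>m m)"
proof (induction m)
  case 0
  then show ?case
    using assms by (auto simp: nonneg_matrix_def complex_nonneg_Reals_iff one_mat_def)
next
  case (Suc m)
  have C: "A ^\<^sub>m m \<in> carrier_mat n n"
    using assms by simp
  show ?case
    unfolding nonneg_matrix_def
  proof (intro allI impI)
    fix i j
    assume "i < dim_row (A ^\<^sub>m Suc m)" "j < dim_col (A ^\<^sub>m Suc m)"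
    then have ij: "i < n" "j < n"
      using assms by auto
    show "(A ^\<^sub>m Suc m) $$ (i, j) \<in> \<real>\<^sub>\<ge>\<^sub>0"
      using nonneg_mult_entry[OF Suc C assms ij]
        nonneg_matrixD[OF Suc C] nonneg_matrixD[OF assms] ij
      by (auto simp: complex_nonneg_Reals_iff intro!: sum_nonneg)
  qed
qed

lemma subinvariant_pow:
  assumes A: "nonneg_matrix A" "A \<in> carrier_mat n n"
    and g: "0 \<le> g"
    and sub: "\<And>i. i < n \<Longrightarrow> g * x i \<le> (\<Sum>j\<in>{0..<n}. Re (A $$ (i, j)) * x j)"
    and i: "i < n"
  shows "g ^ m * x i \<le> (\<Sum>j\<in>{0..<n}. Re ((A ^\<^sub>m m) $$ (i, j)) * x j)"
proof (induction m)
  case 0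
  have "(\<Sum>j\<in>{0..<n}. Re ((1\<^sub>m n :: complex mat) $$ (i, j)) * x j)
      = (\<Sum>j\<in>{0..<n}. if j = i then x j else 0)"
    using i by (intro sum.cong) auto
  then show ?case
    using i A by simp
next
  case (Suc m)
  let ?P = "A ^\<^sub>m m"
  have P: "nonneg_matrix ?P" "?P \<in> carrier_mat n n"
    using A nonneg_matrix_pow by auto
  have "g ^ Suc m * x i \<le> g * (\<Sum>k\<in>{0..<n}. Re (?P $$ (i, k)) * x k)"
    using mult_left_mono[OF Suc g] by (simp add: mult.assoc)
  also have "\<dots> = (\<Sum>k\<in>{0..<n}. Re (?P $$ (i, k)) * (g * x k))"
    by (simp add: sum_distrib_left algebra_simps)
  also have "\<dots> \<le> (\<Sum>k\<in>{0..<n}. Re (?P $$ (i, k)) * (\<Sum>j\<in>{0..<n}. Re (A $$ (k, j)) * x j))"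
    using sub nonneg_matrixD[OF P i] by (intro sum_mono mult_left_mono) auto
  also have "\<dots> = (\<Sum>k\<in>{0..<n}. \<Sum>j\<in>{0..<n}. Re (?P $$ (i, k)) * Re (A $$ (k, j)) * x j)"
    by (simp add: sum_distrib_left mult.assoc)
  also have "\<dots> = (\<Sum>j\<in>{0..<n}. \<Sum>k\<in>{0..<n}. Re (?P $$ (i, k)) * Re (A $$ (k, j)) * x j)"
    by (rule sum.swap)
  also have "\<dots> = (\<Sum>j\<in>{0..<n}. Re ((A ^\<^sub>m Suc m) $$ (i, j)) * x j)"
    using nonneg_mult_entry(1)[OF P A i] by (intro sum.cong) (auto simp: sum_distrib_right)
  finally show ?case .
qed

text \<open>
  Below spectral radius 1 the powers of a matrix are bounded entrywise, by the Jordan normal form,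
  whereas here the entry \<open>k\<close> of \<open>A\<^sup>m x\<close> grows at least geometrically.
\<close>
lemma spectral_radius_ge_1_if_expanding:
  assumes A: "nonneg_matrix A" "A \<in> carrier_mat n n"
    and g: "1 < g"
    and x: "\<And>i. i < n \<Longrightarrow> 0 \<le> x i" "k < n" "0 < x k"
    and sub: "\<And>i. i < n \<Longrightarrow> g * x i \<le> (\<Sum>j\<in>{0..<n}. Re (A $$ (i, j)) * x j)"
  shows "1 \<le> spectral_radius A"
proof (rule ccontr)
  assume "\<not> 1 \<le> spectral_radius A"
  then obtain c where c: "\<And>m. norm_bound (A ^\<^sub>m m) c"
    using spectral_radius_jnf_norm_bound_less_1_upper_triangular[OF A(2)] by auto
  have bound: "g ^ m * x k \<le> c * (\<Sum>j\<in>{0..<n}. x j)" for m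
  proof -
    have entry: "Re ((A ^\<^sub>m m) $$ (k, j)) \<le> c" if "j < n" for j
    proof -
      have "cmod ((A ^\<^sub>m m) $$ (k, j)) \<le> c"
        using c[of m] A(2) x(2) that by (simp add: norm_bound_def)
      with complex_Re_le_cmod show ?thesis
        by (rule order_trans)
    qed
    have "g ^ m * x k \<le> (\<Sum>j\<in>{0..<n}. Re ((A ^\<^sub>m m) $$ (k, j)) * x j)"
      using A g sub x(2) by (intro subinvariant_pow) auto
    also have "\<dots> \<le> (\<Sum>j\<in>{0..<n}. c * x j)"
      using entry x(1) by (intro sum_mono mult_right_mono) auto
    finally show ?thesis
      by (simp add: sum_distrib_left)
  qed
  obtain m where "c * (\<Sum>j\<in>{0..<n}. x j) / x k < g ^ m"
    using real_arch_pow[OF g] by blast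
  with bound[of m] x(3) show False
    by (simp add: pos_divide_less_eq)
qed

text \<open>
  An eigenvector of \<open>c A\<close> for \<open>e\<close> is one of \<open>A\<close> for \<open>e / c\<close>. This inequality allows
  the bound on powers to be applied after rescaling.
\<close>
lemma spectral_radius_smult_le:
  assumes A: "A \<in> carrier_mat n n" and n: "0 < n" and c: "0 < c"
  shows "spectral_radius (complex_of_real c \<cdot>\<^sub>m A) \<le> c * spectral_radius A"
proof -
  let ?B = "complex_of_real c \<cdot>\<^sub>m A"
  have B: "?B \<in> carrier_mat n n"
    using A by simp
  obtain e where e: "e \<in> spectrum ?B" and sr: "spectral_radius ?B = cmod e"
    using spectral_radius_mem_max(1)[OF B n] by auto
  obtain v where v: "v \<in> carrier_vec n" "v \<noteq> 0\<^sub>v n" and ev: "?B *\<^sub>v v = e \<cdot>\<^sub>v v"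
    using e B by (auto simp: spectrum_def eigenvalue_def eigenvector_def)
  have "A *\<^sub>v v = (e / c) \<cdot>\<^sub>v v"
  proof (rule eq_vecI)
    show "dim_vec (A *\<^sub>v v) = dim_vec ((e / c) \<cdot>\<^sub>v v)"
      using A v by simp
    fix i
    assume "i < dim_vec ((e / c) \<cdot>\<^sub>v v)"
    then have i: "i < n"
      using v by simp
    have "c * (A *\<^sub>v v) $ i = e * v $ i"
      using arg_cong[OF ev, of "\<lambda>w. w $ i"] i A v by simp
    then show "(A *\<^sub>v v) $ i = ((e / c) \<cdot>\<^sub>v v) $ i"
      using c i v by (simp add: field_simps)
  qed
  then have "eigenvector A v (e / c)"
    using A v by (simp add: eigenvector_def)
  then have "e / c \<in> spectrum A"
    by (auto simp: spectrum_def eigenvalue_def)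
  then have "cmod (e / c) \<le> spectral_radius A"
    by (intro spectral_radius_mem_max(2)[OF A n]) auto
  then show ?thesis
    using c sr by (simp add: norm_divide field_simps)
qed

text \<open>
  The lower half of the Collatz--Wielandt characterisation of the spectral radius. The factor
  \<open>\<mu>\<close> is chosen strictly between the spectral radius and \<open>l\<close>, so that \<open>A / \<mu>\<close> has
  spectral radius below 1 and still expands \<open>x\<close>.
\<close>
lemma spectral_radius_ge_subinvariant:
  assumes A: "nonneg_matrix A" "A \<in> carrier_mat n n"
    and x: "\<And>i. i < n \<Longrightarrow> 0 \<le> x i" "k < n" "0 < x k"
    and sub: "\<And>i. i < n \<Longrightarrow> l * x i \<le> (\<Sum>j\<in>{0..<n}. Re (A $$ (i, j)) * x j)"
  shows "l \<le> spectral_radius A"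
proof (rule ccontr)
  let ?r = "spectral_radius A"
  assume "\<not> l \<le> ?r"
  then obtain \<mu> where \<mu>: "?r < \<mu>" "\<mu> < l"
    using dense by (metis not_le)
  have n: "0 < n"
    using x(2) by simp
  have "0 \<le> ?r"
    using spectral_radius_mem_max(1)[OF A(2) n] by auto
  with \<mu> have \<mu>0: "0 < \<mu>"
    by simp
  define B where "B = complex_of_real (1 / \<mu>) \<cdot>\<^sub>m A"
  have B: "B \<in> carrier_mat n n"
    using A(2) by (simp add: B_def)
  have entry: "Re (B $$ (i, j)) = Re (A $$ (i, j)) / \<mu>" "Im (B $$ (i, j)) = Im (A $$ (i, j)) / \<mu>"
    if "i < n" "j < n" for i j
    using that A(2) by (auto simp: B_def)
  have "nonneg_matrix B"
    using entry nonneg_matrixD[OF A] B \<mu>0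
    by (auto simp: nonneg_matrix_def complex_nonneg_Reals_iff)
  then have "1 \<le> spectral_radius B"
  proof (rule spectral_radius_ge_1_if_expanding[OF _ B, where g = "l / \<mu>" and x = x and k = k])
    show "1 < l / \<mu>"
      using \<mu> \<mu>0 by simp
    fix i
    assume i: "i < n"
    have "(\<Sum>j\<in>{0..<n}. Re (B $$ (i, j)) * x j) = (\<Sum>j\<in>{0..<n}. Re (A $$ (i, j)) * x j) / \<mu>"
      using entry i by (simp add: sum_divide_distrib)
    then show "l / \<mu> * x i \<le> (\<Sum>j\<in>{0..<n}. Re (B $$ (i, j)) * x j)"
      using sub[OF i] \<mu>0 by (simp add: divide_right_mono)
  qed (use x in auto)
  also have "\<dots> \<le> 1 / \<mu> * ?r"
    unfolding B_def using A(2) n \<mu>0 by (intro spectral_radius_smult_le) auto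
  also have "\<dots> < 1"
    using \<mu> \<mu>0 by simp
  finally show False
    by simp
qed

section \<open>The star bound\<close>

text \<open>
  Sorting is a bijection of positions, so the entries at \<open>i\<close> and \<open>j\<close> go to two distinct
  positions, the smaller of which is at least 0 and the larger at least 1. Arguing by positions
  counts repeated values with multiplicity.
\<close>
lemma sort_two_smallest_le:
  fixes xs :: "'a :: {linorder, ordered_ab_semigroup_add} list"
  assumes "i < length xs" "j < length xs" "i \<noteq> j"
  shows "sort xs ! 0 + sort xs ! 1 \<le> xs ! i + xs ! j"
proof -
  obtain f where f: "bij_betw f {..<length xs} {..<length (sort xs)}"
    "\<And>i. i < length xs \<Longrightarrow> xs ! i = sort xs ! f i"
    using permutation_Ex_bij[of xs "sort xs"] by auto
  have len: "f i < length xs" "f j < length xs"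
    using bij_betwE[OF f(1)] assms by auto
  have "f i \<noteq> f j"
    using bij_betw_imp_inj_on[OF f(1)] assms by (auto dest: inj_onD)
  have *: "sort xs ! 0 + sort xs ! 1 \<le> sort xs ! a + sort xs ! b"
    if "a < b" "b < length xs" for a b
    using that by (intro add_mono sorted_nth_mono) auto
  show ?thesis
    using *[of "f i" "f j"] *[of "f j" "f i"] len \<open>f i \<noteq> f j\<close> f(2) assms
    by (auto simp: add.commute neq_iff)
qed

lemma sorted_diag_two_smallest_le:
  assumes "A \<in> carrier_mat n n" "i < n" "j < n" "i \<noteq> j"
  shows "sorted_diag A ! 0 + sorted_diag A ! 1 \<le> Re (A $$ (i, i)) + Re (A $$ (j, j))"
  using sort_two_smallest_le[of i "map Re (diag_mat A)" j] assms
  by (simp add: sorted_diag_def diag_mat_def)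

lemma two_terms_le_sum:
  fixes f :: "'a \<Rightarrow> real"
  assumes "finite I" "i \<in> I" "j \<in> I" "i \<noteq> j" "\<And>l. l \<in> I \<Longrightarrow> 0 \<le> f l"
  shows "f i + f j \<le> sum f I"
  using sum_mono2[of I "{i, j}" f] assms by auto

text \<open>
  The test vector is the one of a star with centre \<open>k\<close>, whose entry at the centre is
  \<open>c = (p - q) / 2 + s\<close>. When \<open>c \<le> 0\<close> it is not available, but then \<open>l \<le> q\<close>, so a single
  diagonal entry away from \<open>k\<close> is large enough; such an entry exists because \<open>n \<ge> 2\<close>.
\<close>
lemma spectral_radius_ge_star:
  assumes A: "nonneg_matrix A" "A \<in> carrier_mat n n" and n: "2 \<le> n" and k: "k < n"
  shows "(sorted_diag A ! 0 + sorted_diag A ! 1) / 2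
      + sqrt (\<Sum>j\<in>{0..<n} - {k}. (min_sym_entry A j k)\<^sup>2) \<le> spectral_radius A"
proof -
  define a where "a = (\<lambda>i j. Re (A $$ (i, j)))"
  define y where "y = (\<lambda>j. min_sym_entry A j k)"
  define s where "s = sqrt (\<Sum>j\<in>{0..<n} - {k}. (y j)\<^sup>2)"
  define t where "t = sorted_diag A ! 0 + sorted_diag A ! 1"
  define p where "p = a k k"
  define q where "q = t - p"
  define l where "l = t / 2 + s"
  define c where "c = l - q"
  have a0: "0 \<le> a i j" if "i < n" "j < n" for i j
    using nonneg_matrixD(1)[OF A that] by (simp add: a_def)
  have y: "0 \<le> y j" "y j \<le> a j k" "y j \<le> a k j" if "j < n" for j
    using a0[OF that k] a0[OF k that] by (auto simp: y_def min_sym_entry_def a_def)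
  have s2: "s\<^sup>2 = (\<Sum>j\<in>{0..<n} - {k}. (y j)\<^sup>2)"
    by (simp add: s_def sum_nonneg)
  have q: "q \<le> a j j" if "j < n" "j \<noteq> k" for j
    using sorted_diag_two_smallest_le[OF A(2) that(1) k that(2)]
    by (simp add: q_def t_def p_def a_def)
  have "l \<le> spectral_radius A"
  proof (cases "0 < c")
    case True
    define x where "x = (\<lambda>i. if i = k then c else y i)"
    have x0: "0 \<le> x i" if "i < n" for i
      using True y that by (simp add: x_def)
    show ?thesis
    proof (rule spectral_radius_ge_subinvariant[OF A, of x])
      show "k < n" "0 < x k"
        using k True by (auto simp: x_def)
      fix i
      assume i: "i < n"
      have "l * x i \<le> (\<Sum>j\<in>{0..<n}. a i j * x j)"
      proof (cases "i = k")
        case True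
        \<comment> \<open>the square subtracted here is the slack from using \<open>l\<close> in place of the star's eigenvalue\<close>
        have "(l - p) * c = s\<^sup>2 - ((p - q) / 2)\<^sup>2"
          by (simp add: c_def l_def q_def power2_eq_square field_simps)
        also have "\<dots> \<le> s\<^sup>2"
          by simp
        finally have "l * c \<le> p * c + s\<^sup>2"
          by (simp add: algebra_simps)
        also have "\<dots> \<le> a k k * x k + (\<Sum>j\<in>{0..<n} - {k}. a k j * x j)"
          unfolding s2 using y by (auto simp: p_def x_def power2_eq_square intro!: sum_mono mult_right_mono)
        also have "\<dots> = (\<Sum>j\<in>{0..<n}. a k j * x j)"
          using k by (simp add: sum.remove)
        finally show ?thesis
          using True by (simp add: x_def)
      next
        case False
        have "l * x i = q * y i + y i * c"
          using False by (simp add: x_def c_def algebra_simps)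
        also have "\<dots> \<le> a i i * x i + a i k * x k"
          using False q[OF i] y[OF i] \<open>0 < c\<close>
          by (auto simp: x_def intro!: add_mono mult_right_mono)
        also have "\<dots> \<le> (\<Sum>j\<in>{0..<n}. a i j * x j)"
          using False i k x0 a0 by (intro two_terms_le_sum) auto
        finally show ?thesis .
      qed
      then show "l * x i \<le> (\<Sum>j\<in>{0..<n}. Re (A $$ (i, j)) * x j)"
        by (simp add: a_def)
    qed (use x0 in auto)
  next
    case False
    obtain j where j: "j < n" "j \<noteq> k"
      using n by (intro that[of "if k = 0 then 1 else 0"]) auto
    define x :: "nat \<Rightarrow> real" where "x = (\<lambda>i. if i = j then 1 else 0)"
    have "l \<le> a j j"
      using False q[OF j] by (simp add: c_def)
    show ?thesis
    proof (rule spectral_radius_ge_subinvariant[OF A, of x])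
      fix i
      assume i: "i < n"
      show "l * x i \<le> (\<Sum>j\<in>{0..<n}. Re (A $$ (i, j)) * x j)"
        using \<open>l \<le> a j j\<close> a0[OF i j(1)] j by (auto simp: x_def a_def if_distrib[of "(*) _"] cong: if_cong)
    qed (use j in \<open>auto simp: x_def\<close>)
  qed
  then show ?thesis
    by (simp add: l_def t_def s_def y_def)
qed

theorem corollary2p4:
  fixes A :: "complex mat" and n :: nat
  assumes "n \<ge> 2"
    and "A \<in> carrier_mat n n"
    and "nonneg_matrix A"
  shows "spectral_radius A \<ge>
      (sorted_diag A ! 0 + sorted_diag A ! 1) / 2
      + (MAX k \<in> {0..<n}. sqrt (\<Sum>j \<in> {0..<n} - {k}. (min_sym_entry A j k)\<^sup>2))"
proof -
  let ?f = "\<lambda>k. sqrt (\<Sum>j \<in> {0..<n} - {k}. (min_sym_entry A j k)\<^sup>2)"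
  have "Max (?f ` {0..<n}) \<in> ?f ` {0..<n}"
    using assms(1) by (intro Max_in) auto
  then obtain k where "k < n" "Max (?f ` {0..<n}) = ?f k"
    by auto
  then show ?thesis
    using spectral_radius_ge_star[OF assms(3,2,1)] by simp
qed

end
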